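(* Let $R$ be a commutative reduced local ring. Then $R$ is Hopfian if and only if the polynomial ring $R[x]$ in one variable is Hopfian.
   Context: All rings are commutative with a non-zero identity. A local ring is a ring with exactly one maximal ideal (it is not assumed to be Noetherian). A ring $A$ is called Hopfian if every surjective ring homomorphism $A\to A$ is an automorphism. *)

theory Defs
  imports "HOL-Algebra.QuotRing" "HOL-Algebra.UnivPoly"
begin

locale local_ring = cring +
  assumes one_not_zero: "\<one> \<noteq> \<zero>"
    and unique_maximalideal: "\<exists>!M. maximalideal M R"

locale reduced_ring = cring +
  assumes nilpotent_zero: "\<lbrakk>x \<in> carrier R; x [^] (n::nat) = \<zero>\<rbrakk> \<Longrightarrow> x = \<zero>"

definition hopfian_ring :: "('a, 'm) ring_scheme \<Rightarrow> bool"
  where "hopfian_ring A \<longleftrightarrow>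
    (\<forall>f \<in> ring_hom A A. f ` carrier A = carrier A \<longrightarrow> f \<in> ring_iso A A)"

end

theory Submission
  imports Defs "HOL-Algebra.Ring_Divisibility"
begin

text \<open>Let \<open>\<phi>\<close> be a surjective endomorphism of \<open>R[x]\<close>. As \<open>R\<close> is local, \<open>a\<close> or \<open>1 - a\<close> is a unit for
  every \<open>a \<in> R\<close>, and as \<open>R\<close> is reduced, the units of \<open>R[x]\<close> are constant; hence \<open>\<phi>\<close> restricts to an
  endomorphism \<open>f\<close> of \<open>R\<close>, and \<open>\<phi> (\<Sum> a\<^sub>i x\<^sup>i) = \<Sum> f(a\<^sub>i) g\<^sup>i\<close> with \<open>g = \<phi>(x)\<close>. Let \<open>b\<close> be the leading
  coefficient of \<open>g\<close>. In a reduced ring, \<open>b\<close> annihilates each \<open>f(a\<^sub>i)\<close>, \<open>i \<ge> j\<close>, as soon as the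
  coefficients of \<open>\<phi>(p)\<close> in the degrees \<open>i deg g\<close>, \<open>i \<ge> j\<close>, vanish. Applied to a preimage of \<open>x\<close> this
  forces \<open>deg g = 1\<close> and \<open>b = b f(h\<^sub>1) b\<close>, so \<open>b\<close> is a unit. Applied to preimages of constants it then
  shows that \<open>f\<close> is surjective, hence injective, and applied to the kernel that \<open>\<phi>\<close> is injective.\<close>

section \<open>Maximal ideals, units of local rings, and reducedness\<close>

lemma (in ring) proper_ideal_subset_maximalideal:
  assumes "ideal I R" "I \<noteq> carrier R"
  shows "\<exists>M. maximalideal M R \<and> I \<subseteq> M"
proof -
  \<comment> \<open>Properness is encoded as the absence of 1, a property that passes to unions of
    chains, as Zorn's lemma requires.\<close>
  define S where "S = {J. ideal J R \<and> I \<subseteq> J \<and> \<one> \<notin> J}"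
  have "I \<in> S"
    using assms ideal.one_imp_carrier by (auto simp: S_def)
  moreover have "\<Union>C \<in> S" if "C \<noteq> {}" "subset.chain S C" for C
  proof -
    have "subset.chain {J. ideal J R} C" and sub: "C \<subseteq> S"
      using that by (auto simp: pred_on.chain_def S_def)
    then have "ideal (\<Union>C) R"
      using chain_Union_is_ideal[of C] that(1) by simp
    then show ?thesis
      using sub that(1) by (auto simp: S_def)
  qed
  ultimately obtain M where M: "M \<in> S" "\<And>J. J \<in> S \<Longrightarrow> M \<subseteq> J \<Longrightarrow> J = M"
    using subset_Zorn_nonempty[of S] by blast
  have "maximalideal M R"
  proof (rule maximalidealI)
    show "J = M \<or> J = carrier R" if "ideal J R" "M \<subseteq> J" "J \<subseteq> carrier R" for J
      using that M(1) M(2)[of J] ideal.one_imp_carrier[OF that(1)] by (fastforce simp: S_def)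
  qed (use M(1) in \<open>auto simp: S_def\<close>)
  then show ?thesis
    using M(1) by (auto simp: S_def)
qed

text \<open>Two non-units each generate a proper ideal, so both lie in the unique maximal ideal; it
  cannot contain both a and 1 - a, whose sum is 1.\<close>

lemma (in local_ring) unit_or_one_minus_unit:
  assumes a: "a \<in> carrier R"
  shows "a \<in> Units R \<or> \<one> \<ominus> a \<in> Units R"
proof (rule ccontr)
  assume non_units: "\<not> ?thesis"
  have in_max: "\<exists>M. maximalideal M R \<and> b \<in> M" if "b \<in> carrier R" "b \<notin> Units R" for b
    using proper_ideal_subset_maximalideal[OF cgenideal_ideal[OF that(1)]]
      ideal_eq_carrier_iff[OF that(1)] cgenideal_self[OF that(1)] that(2) by blast
  obtain M where M: "maximalideal M R" "a \<in> M" "\<one> \<ominus> a \<in> M"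
    using in_max[of a] in_max[of "\<one> \<ominus> a"] unique_maximalideal non_units a by blast
  interpret M: maximalideal M R by fact
  have "a \<oplus> (\<one> \<ominus> a) \<in> M"
    using M by (intro M.a_closed)
  moreover have "a \<oplus> (\<one> \<ominus> a) = \<one>"
    using a by algebra
  ultimately show False
    using M.one_imp_carrier M.I_notcarr by simp
qed

text \<open>The hypothesis makes c a nilpotent, because
  \<open>c \<otimes> a \<otimes> c [^] k\<close> divides its power with exponent k + 1.\<close>

lemma (in reduced_ring) mult_zero_if_mult_pow_zero:
  assumes "a \<in> carrier R" "c \<in> carrier R" "c \<otimes> a \<otimes> c [^] (k::nat) = \<zero>"
  shows "c \<otimes> a = \<zero>"
proof (rule nilpotent_zero[of _ "Suc k"])
  have "(c \<otimes> a) [^] Suc k = (c \<otimes> a \<otimes> c [^] k) \<otimes> a [^] k"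
    using assms(1,2) by (simp add: nat_pow_distrib m_ac)
  then show "(c \<otimes> a) [^] Suc k = \<zero>"
    using assms by simp
qed (use assms in simp)

section \<open>Top coefficients in the polynomial ring\<close>

context UP_cring
begin

text \<open>In the convolution sum an index below m exceeds the bound for q, and one above m the
  bound for p. Bounds instead of exact degrees keep this applicable when top coefficients multiply
  to zero.\<close>

lemma coeff_mult_top:
  assumes "p \<in> carrier P" "q \<in> carrier P" "deg R p \<le> m" "deg R q \<le> n"
  shows "coeff P (p \<otimes>\<^bsub>P\<^esub> q) (m + n) = coeff P p m \<otimes> coeff P q n"
proof -
  have "coeff P p i \<otimes> coeff P q (m + n - i) = (if m = i then coeff P p m \<otimes> coeff P q n else \<zero>)"
    if "i \<le> m + n" for i
  proof (cases i m rule: linorder_cases)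
    case less
    then have "deg R q < m + n - i" using assms by linarith
    then show ?thesis using less assms by (simp add: deg_aboveD)
  next
    case greater
    then have "deg R p < i" using assms by linarith
    then show ?thesis using greater assms by (simp add: deg_aboveD)
  qed simp
  then have "coeff P (p \<otimes>\<^bsub>P\<^esub> q) (m + n) =
      (\<Oplus>i\<in>{..m + n}. if m = i then coeff P p m \<otimes> coeff P q n else \<zero>)"
    using assms by (simp only: coeff_mult) (intro R.finsum_cong', auto)
  also have "\<dots> = coeff P p m \<otimes> coeff P q n"
    using assms R.finsum_singleton[of m "{..m + n}" "\<lambda>_. coeff P p m \<otimes> coeff P q n"]
    by (simp add: Pi_def)
  finally show ?thesis .
qed

text \<open>The degree is only bounded, since a power of the leading coefficient may vanish in a
  general commutative ring.\<close>

lemma pow_degree_and_top: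
  assumes "p \<in> carrier P"
  shows "deg R (p [^]\<^bsub>P\<^esub> (i::nat)) \<le> deg R p * i \<and>
    coeff P (p [^]\<^bsub>P\<^esub> i) (deg R p * i) = coeff P p (deg R p) [^] i"
proof (induction i)
  case (Suc i)
  have "deg R (p [^]\<^bsub>P\<^esub> i \<otimes>\<^bsub>P\<^esub> p) \<le> deg R (p [^]\<^bsub>P\<^esub> i) + deg R p"
    using assms by (intro deg_mult_ring) auto
  moreover have "coeff P (p [^]\<^bsub>P\<^esub> i \<otimes>\<^bsub>P\<^esub> p) (deg R p * i + deg R p)
      = coeff P p (deg R p) [^] i \<otimes> coeff P p (deg R p)"
    using Suc assms by (subst coeff_mult_top) auto
  ultimately show ?case
    using Suc by (simp add: add.commute)
qed simp

lemma coeff_smult_sum: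
  fixes v :: "nat \<Rightarrow> 'a"
  assumes "v \<in> UNIV \<rightarrow> carrier R" "q \<in> UNIV \<rightarrow> carrier P"
  shows "coeff P (\<Oplus>\<^bsub>P\<^esub>i\<in>{..n}. v i \<odot>\<^bsub>P\<^esub> q i) s = (\<Oplus>i\<in>{..n}. v i \<otimes> coeff P (q i) s)"
proof -
  have "v i \<in> carrier R" "q i \<in> carrier P" for i
    using assms by auto
  then show ?thesis
    by (subst coeff_finsum) (auto simp: Pi_def)
qed

text \<open>Downward induction: once \<open>c\<close> kills all \<open>v i\<close> with \<open>i > t\<close>, the coefficient of
  \<open>c \<odot> (\<Oplus>i. v i \<odot> q i)\<close> at \<open>d t\<close> is just \<open>c \<otimes> v t \<otimes> c [^] k t\<close>.\<close>

lemma top_coeff_annihilates: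
  fixes d k :: "nat \<Rightarrow> nat"
  assumes red: "reduced_ring R"
    and v: "v \<in> UNIV \<rightarrow> carrier R" and q: "q \<in> UNIV \<rightarrow> carrier P" and c: "c \<in> carrier R"
    and d: "strict_mono d" and deg: "\<And>i. deg R (q i) \<le> d i"
    and top: "\<And>i. coeff P (q i) (d i) = c [^] k i"
    and vanish: "\<And>t. j \<le> t \<Longrightarrow> t \<le> n \<Longrightarrow>
      coeff P (\<Oplus>\<^bsub>P\<^esub>i\<in>{..n}. v i \<odot>\<^bsub>P\<^esub> q i) (d t) = \<zero>"
    and t: "j \<le> t" "t \<le> n"
  shows "c \<otimes> v t = \<zero>"
  using t
proof (induction "n - t" arbitrary: t rule: less_induct)
  case less
  have [simp]: "v i \<in> carrier R" "q i \<in> carrier P" for i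
    using v q by auto
  have summand: "c \<otimes> (v i \<otimes> coeff P (q i) (d t)) = (if t = i then c \<otimes> v t \<otimes> c [^] k t else \<zero>)"
    if "i \<le> n" for i
  proof (cases i t rule: linorder_cases)
    case less
    then have "deg R (q i) < d t"
      using deg[of i] strict_monoD[OF d less] by linarith
    then show ?thesis using less c by (simp add: deg_aboveD)
  next
    case equal
    then show ?thesis using c by (simp add: top R.m_assoc)
  next
    case greater
    then have "c \<otimes> v i = \<zero>"
      using less.hyps[of i] less.prems that by simp
    then show ?thesis
      using greater c by (simp flip: R.m_assoc)
  qed
  have "\<zero> = c \<otimes> coeff P (\<Oplus>\<^bsub>P\<^esub>i\<in>{..n}. v i \<odot>\<^bsub>P\<^esub> q i) (d t)"
    using vanish less.prems c by simp
  also have "\<dots> = (\<Oplus>i\<in>{..n}. c \<otimes> (v i \<otimes> coeff P (q i) (d t)))"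
    using c by (simp add: coeff_smult_sum[OF v q] R.finsum_rdistr Pi_def)
  also have "\<dots> = (\<Oplus>i\<in>{..n}. if t = i then c \<otimes> v t \<otimes> c [^] k t else \<zero>)"
    using summand c by (intro R.finsum_cong') auto
  also have "\<dots> = c \<otimes> v t \<otimes> c [^] k t"
    using R.finsum_singleton[of t "{..n}" "\<lambda>_. c \<otimes> v t \<otimes> c [^] k t"] less.prems c
    by (simp add: Pi_def)
  \<comment> \<open>Reducedness now removes the power of c.\<close>
  finally have "c \<otimes> v t \<otimes> c [^] k t = \<zero>"
    by (rule sym)
  then show ?case
    by (rule reduced_ring.mult_zero_if_mult_pow_zero[OF red \<open>v t \<in> carrier R\<close> c])
qed

section \<open>Units and endomorphisms of the polynomial ring\<close>

text \<open>If u has positive degree, leading coefficient c and inverse w, then w u = 1 has no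
  coefficient in the degrees i + deg u. This forces c to annihilate every coefficient of w, whence c
  = c w u = 0.\<close>

lemma unit_is_constant:
  assumes red: "reduced_ring R" and u: "u \<in> Units P"
  shows "deg R u = 0"
proof (rule ccontr)
  assume deg: "deg R u \<noteq> 0"
  obtain w where uw: "u \<in> carrier P" "w \<in> carrier P" "w \<otimes>\<^bsub>P\<^esub> u = \<one>\<^bsub>P\<^esub>"
    using u by (auto simp: Units_def)
  define c where "c = coeff P u (deg R u)"
  have c: "c \<in> carrier R" "c \<noteq> \<zero>"
    using deg uw lcoeff_nonzero_deg by (auto simp: c_def)
  have "c \<otimes> coeff P w t = \<zero>" for t
  proof (cases "t \<le> deg R w")
    case True
    \<comment> \<open>The product w u is put in the form \<Sum> v_i q_i of
      \<open>top_coeff_annihilates\<close>, with q_i = x^i u; every q_i has top coefficient c, so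
      the exponent \<open>k\<close> is constantly 1.\<close>
    have "(\<Oplus>\<^bsub>P\<^esub>i\<in>{..deg R w}. coeff P w i \<odot>\<^bsub>P\<^esub> (monom P \<one> i \<otimes>\<^bsub>P\<^esub> u))
        = (\<Oplus>\<^bsub>P\<^esub>i\<in>{..deg R w}. monom P (coeff P w i) i \<otimes>\<^bsub>P\<^esub> u)"
      using uw by (intro P.finsum_cong') (auto simp flip: UP_smult_assoc2 monom_mult_smult)
    also have "\<dots> = (\<Oplus>\<^bsub>P\<^esub>i\<in>{..deg R w}. monom P (coeff P w i) i) \<otimes>\<^bsub>P\<^esub> u"
      using uw by (subst P.finsum_ldistr) auto
    also have "\<dots> = \<one>\<^bsub>P\<^esub>"
      using uw up_repr by simp
    finally have sum: "(\<Oplus>\<^bsub>P\<^esub>i\<in>{..deg R w}. coeff P w i \<odot>\<^bsub>P\<^esub> (monom P \<one> i \<otimes>\<^bsub>P\<^esub> u)) = \<one>\<^bsub>P\<^esub>" .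
    have "deg R (monom P \<one> i \<otimes>\<^bsub>P\<^esub> u) \<le> i + deg R u" for i
      using deg_mult_ring[of "monom P \<one> i" u] deg_monom_le[of \<one> i] uw by simp
    moreover have "coeff P (monom P \<one> i \<otimes>\<^bsub>P\<^esub> u) (i + deg R u) = c [^] (1::nat)" for i
      using uw deg_monom_le[of \<one> i] by (subst coeff_mult_top) (auto simp: c_def)
    ultimately show ?thesis
      using deg uw c True
      by (intro top_coeff_annihilates[OF red, where q = "\<lambda>i. monom P \<one> i \<otimes>\<^bsub>P\<^esub> u" and
          d = "\<lambda>i. i + deg R u" and k = "\<lambda>_. 1" and j = 0 and n = "deg R w"])
        (auto simp: sum strict_mono_def)
  next
    case False
    then show ?thesis using uw c by (simp add: deg_aboveD)
  qed
  then have "c \<odot>\<^bsub>P\<^esub> w = \<zero>\<^bsub>P\<^esub>"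
    using c uw by (intro up_eqI) auto
  then have "c \<odot>\<^bsub>P\<^esub> \<one>\<^bsub>P\<^esub> = \<zero>\<^bsub>P\<^esub>"
    using c uw UP_smult_assoc2[of c w u] by simp
  then have "coeff P (c \<odot>\<^bsub>P\<^esub> \<one>\<^bsub>P\<^esub>) 0 = \<zero>"
    by simp
  then show False
    using c by simp
qed

text \<open>Units map to units, which are constant. If a is not a unit, then 1 - a is one, and a = 1
  - (1 - a) is again sent to a constant.\<close>

lemma hom_maps_constants:
  assumes loc: "local_ring R" and red: "reduced_ring R"
    and \<phi>: "\<phi> \<in> ring_hom P P" and a: "a \<in> carrier R"
  shows "\<exists>b \<in> carrier R. \<phi> (monom P a 0) = monom P b 0"
proof -
  interpret \<phi>: ring_hom_cring P P \<phi>
    using \<phi> UP_cring by (simp add: ring_hom_cring_def ring_hom_cring_axioms_def)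
  have unit: "\<exists>b \<in> carrier R. \<phi> (monom P u 0) = monom P b 0" if u: "u \<in> Units R" for u
  proof -
    have "monom P u 0 \<otimes>\<^bsub>P\<^esub> monom P (inv u) 0 = \<one>\<^bsub>P\<^esub>"
      using u ring_hom_mult[OF const_ring_hom, of u "inv u"] R.Units_closed[OF u] by simp
    then have "\<phi> (monom P u 0) \<otimes>\<^bsub>P\<^esub> \<phi> (monom P (inv u) 0) = \<one>\<^bsub>P\<^esub>"
      using u \<phi>.hom_mult[of "monom P u 0" "monom P (inv u) 0"] by (simp add: R.Units_closed)
    then have "\<phi> (monom P u 0) \<otimes>\<^bsub>P\<^esub> \<phi> (monom P (inv u) 0) \<in> Units P"
      by (simp only: P.Units_one_closed)
    then have "\<phi> (monom P u 0) \<in> Units P"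
      by (rule P.unit_factor) (use R.Units_closed[OF u] u in simp_all)
    then have "deg R (\<phi> (monom P u 0)) = 0"
      by (rule unit_is_constant[OF red])
    then show ?thesis
      using deg_zero_impl_monom[of "\<phi> (monom P u 0)"] R.Units_closed[OF u] by force
  qed
  show ?thesis
    using local_ring.unit_or_one_minus_unit[OF loc a]
  proof
    assume "\<one> \<ominus> a \<in> Units R"
    then obtain b where b: "b \<in> carrier R" "\<phi> (monom P (\<one> \<ominus> a) 0) = monom P b 0"
      using unit by blast
    have "a = \<one> \<ominus> (\<one> \<ominus> a)"
      using a by algebra
    then have "monom P a 0 = \<one>\<^bsub>P\<^esub> \<ominus>\<^bsub>P\<^esub> monom P (\<one> \<ominus> a) 0"
      using a by (intro up_eqI) (auto simp: coeff_minus a_minus_def)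
    then have "\<phi> (monom P a 0) = \<one>\<^bsub>P\<^esub> \<ominus>\<^bsub>P\<^esub> monom P b 0"
      using a b by (simp add: P.minus_eq)
    also have "\<dots> = monom P (\<one> \<ominus> b) 0"
      using b by (intro up_eqI) (auto simp: coeff_minus a_minus_def)
    finally show ?thesis
      using b by blast
  qed (rule unit)
qed

lemma ring_hom_expansion:
  assumes \<phi>: "\<phi> \<in> ring_hom P P" and f: "f \<in> carrier R \<rightarrow> carrier R"
    and const: "\<And>a. a \<in> carrier R \<Longrightarrow> \<phi> (monom P a 0) = monom P (f a) 0"
    and p: "p \<in> carrier P"
  shows "\<phi> p = (\<Oplus>\<^bsub>P\<^esub>i\<in>{..deg R p}. f (coeff P p i) \<odot>\<^bsub>P\<^esub> (\<phi> (monom P \<one> 1) [^]\<^bsub>P\<^esub> i))"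
proof -
  interpret \<phi>: ring_hom_cring P P \<phi>
    using \<phi> UP_cring by (simp add: ring_hom_cring_def ring_hom_cring_axioms_def)
  have monom_eq: "\<phi> (monom P a i) = f a \<odot>\<^bsub>P\<^esub> (\<phi> (monom P \<one> 1) [^]\<^bsub>P\<^esub> i)" if a: "a \<in> carrier R" for a i
  proof -
    have fa: "f a \<in> carrier R" using f a by auto
    have "monom P a i = monom P a 0 \<otimes>\<^bsub>P\<^esub> (monom P \<one> 1 [^]\<^bsub>P\<^esub> i)"
      using a monom_mult[of a \<one> 0 i] by (simp add: monom_pow)
    then have "\<phi> (monom P a i) = monom P (f a) 0 \<otimes>\<^bsub>P\<^esub> (\<phi> (monom P \<one> 1) [^]\<^bsub>P\<^esub> i)"
      using a const by simp
    then show ?thesis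
      using fa by (simp add: monom_mult_is_smult)
  qed
  have term_eq: "\<phi> (monom P (coeff P p i) i) =
      f (coeff P p i) \<odot>\<^bsub>P\<^esub> (\<phi> (monom P \<one> 1) [^]\<^bsub>P\<^esub> i)" for i
    using p by (intro monom_eq) simp
  have "\<phi> p = \<phi> (\<Oplus>\<^bsub>P\<^esub>i\<in>{..deg R p}. monom P (coeff P p i) i)"
    using p by (simp add: up_repr)
  also have "\<dots> = (\<Oplus>\<^bsub>P\<^esub>i\<in>{..deg R p}. \<phi> (monom P (coeff P p i) i))"
    using p by (subst \<phi>.hom_finsum) (auto simp: comp_def)
  finally show ?thesis
    by (simp only: term_eq)
qed

section \<open>Passing the Hopfian property from R to R[x]\<close>

lemma surjective_endomorphism_injective:
  assumes loc: "local_ring R" and red: "reduced_ring R" and hopf: "hopfian_ring R"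
    and \<phi>: "\<phi> \<in> ring_hom P P" and surj: "\<phi> ` carrier P = carrier P"
  shows "inj_on \<phi> (carrier P)"
proof -
  interpret \<phi>: ring_hom_cring P P \<phi>
    using \<phi> UP_cring by (simp add: ring_hom_cring_def ring_hom_cring_axioms_def)
  have nontrivial: "\<one> \<noteq> \<zero>"
    by (rule local_ring.one_not_zero[OF loc])
  \<comment> \<open>Taking the constant coefficient loses nothing, because images of constants are
    constant.\<close>
  define f where "f a = coeff P (\<phi> (monom P a 0)) 0" for a
  define g where "g = \<phi> (monom P \<one> 1)"
  define m where "m = deg R g"
  define b where "b = coeff P g m"
  have f_closed [simp]: "f a \<in> carrier R" if "a \<in> carrier R" for a
    using that by (simp add: f_def)
  have g [simp]: "g \<in> carrier P"
    by (simp add: g_def)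
  have b [simp]: "b \<in> carrier R"
    by (simp add: b_def)
  have const: "\<phi> (monom P a 0) = monom P (f a) 0" if a: "a \<in> carrier R" for a
    using hom_maps_constants[OF loc red \<phi> a] by (auto simp: f_def)
  have f_hom: "f \<in> ring_hom R R"
  proof (rule ring_hom_memI)
    fix x y assume xy: "x \<in> carrier R" "y \<in> carrier R"
    have "monom P (x \<otimes> y) 0 = monom P x 0 \<otimes>\<^bsub>P\<^esub> monom P y 0"
      using xy ring_hom_mult[OF const_ring_hom] by blast
    then have "\<phi> (monom P (x \<otimes> y) 0) = monom P (f x) 0 \<otimes>\<^bsub>P\<^esub> monom P (f y) 0"
      using xy by (simp add: const del: monom_mult)
    then show "f (x \<otimes> y) = f x \<otimes> f y"
      using xy by (simp add: f_def[of "x \<otimes> y"] del: monom_mult flip: ring_hom_mult[OF const_ring_hom])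
    have "\<phi> (monom P (x \<oplus> y) 0) = monom P (f x \<oplus> f y) 0"
      using xy by (simp add: const)
    then show "f (x \<oplus> y) = f x \<oplus> f y"
      using xy by (simp add: f_def[of "x \<oplus> y"])
  next
    show "f \<one> = \<one>"
      by (simp add: f_def)
  qed simp
  interpret f: ring_hom_cring R R f
    using f_hom R.is_cring by (simp add: ring_hom_cring_def ring_hom_cring_axioms_def)
  have expansion: "\<phi> p = (\<Oplus>\<^bsub>P\<^esub>i\<in>{..deg R p}. f (coeff P p i) \<odot>\<^bsub>P\<^esub> (g [^]\<^bsub>P\<^esub> i))"
    if "p \<in> carrier P" for p
    using ring_hom_expansion[OF \<phi> _ const that] by (simp add: g_def)
  have coeff_\<phi>: "coeff P (\<phi> p) s = (\<Oplus>i\<in>{..deg R p}. f (coeff P p i) \<otimes> coeff P (g [^]\<^bsub>P\<^esub> i) s)"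
    if "p \<in> carrier P" for p s
    using that by (subst expansion) (auto intro: coeff_smult_sum)
  obtain h where h: "h \<in> carrier P" "\<phi> h = monom P \<one> 1"
    using surj by (metis imageE monom_closed R.one_closed)
  \<comment> \<open>If g were constant, so would be all its powers, and x could not lie in the
    image.\<close>
  have m_pos: "m > 0"
  proof (rule ccontr)
    assume "\<not> m > 0"
    then have "coeff P (g [^]\<^bsub>P\<^esub> i) 1 = \<zero>" for i :: nat
      using pow_degree_and_top[OF g, of i] by (intro deg_aboveD) (auto simp: m_def)
    then have "coeff P (\<phi> h) 1 = \<zero>"
      using h(1) by (simp add: coeff_\<phi> del: One_nat_def)
    then show False
      using nontrivial by (simp add: h(2))
  qed
  have b_nz: "b \<noteq> \<zero>"
    using m_pos lcoeff_nonzero_deg by (simp add: b_def m_def)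
  have annihilates: "b \<otimes> f (coeff P p t) = \<zero>"
    if p: "p \<in> carrier P" and van: "\<And>t. j \<le> t \<Longrightarrow> coeff P (\<phi> p) (m * t) = \<zero>" and t: "j \<le> t" for p j t
  proof (cases "t \<le> deg R p")
    case True
    show ?thesis
    proof (rule top_coeff_annihilates[OF red, where v = "\<lambda>i. f (coeff P p i)" and
          q = "\<lambda>i. g [^]\<^bsub>P\<^esub> i" and d = "\<lambda>i. m * i" and k = "\<lambda>i. i" and j = j and n = "deg R p"])
      show "strict_mono (\<lambda>i. m * i)"
        using m_pos by (simp add: strict_mono_def)
    qed (use p t True van pow_degree_and_top[OF g] in \<open>auto simp: m_def b_def simp flip: expansion\<close>)
  next
    case False
    then show ?thesis using p by (simp add: deg_aboveD)
  qed
  have h_top: "b \<otimes> f (coeff P h t) = \<zero>" if "2 \<le> t" for t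
  proof (rule annihilates[OF h(1) _ that])
    show "coeff P (\<phi> h) (m * t) = \<zero>" if "2 \<le> t" for t
      using that by (simp add: h(2))
  qed
  \<comment> \<open>Compare linear coefficients in \<phi>(h) = x after multiplying by b: the term i
    = 0 drops out because g^0 = 1, and those with i \<ge> 2 by \<open>h_top\<close>.\<close>
  have b_eq: "b = b \<otimes> f (coeff P h 1) \<otimes> coeff P g 1"
  proof -
    have "b \<otimes> (f (coeff P h i) \<otimes> coeff P (g [^]\<^bsub>P\<^esub> i) 1) =
        (if 1 = i then b \<otimes> f (coeff P h 1) \<otimes> coeff P g 1 else \<zero>)" for i
    proof -
      consider "i = 0" | "i = 1" | "2 \<le> i" by linarith
      then show ?thesis
      proof cases
        case 3
        then show ?thesis
          using h_top[OF 3] h(1) by (simp flip: R.m_assoc)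
      qed (use h(1) in \<open>auto simp: R.m_assoc\<close>)
    qed
    moreover have "b = b \<otimes> coeff P (\<phi> h) 1"
      by (simp add: h(2))
    ultimately have "b = (\<Oplus>i\<in>{..deg R h}. if 1 = i then b \<otimes> f (coeff P h 1) \<otimes> coeff P g 1 else \<zero>)"
      using h(1) by (simp add: coeff_\<phi> R.finsum_rdistr Pi_def del: One_nat_def)
    also have "\<dots> = b \<otimes> f (coeff P h 1) \<otimes> coeff P g 1"
    proof (cases "1 \<le> deg R h")
      case True
      then show ?thesis
        using h(1) R.finsum_singleton[of 1 "{..deg R h}" "\<lambda>_. b \<otimes> f (coeff P h 1) \<otimes> coeff P g 1"]
        by (simp add: Pi_def)
    next
      \<comment> \<open>Here h is constant, so the linear coefficient on the right and the whole sum
        are both zero.\<close>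
      case False
      then have "coeff P h 1 = \<zero>"
        using h(1) by (intro deg_aboveD) auto
      moreover have "(\<Oplus>i\<in>{..deg R h}. if 1 = i then b \<otimes> f (coeff P h 1) \<otimes> coeff P g 1 else \<zero>)
          = (\<Oplus>i\<in>{..deg R h}. \<zero>)"
        using False by (intro R.finsum_cong') auto
      ultimately show ?thesis
        by simp
    qed
    finally show ?thesis .
  qed
  have "m = 1"
  proof (rule ccontr)
    \<comment> \<open>Then no multiple of m equals 1, so x vanishes in all degrees m t; the
      resulting annihilation turns \<open>b_eq\<close> into b = 0.\<close>
    assume "m \<noteq> 1"
    have "b \<otimes> f (coeff P h 1) = \<zero>"
    proof (rule annihilates[OF h(1), of 1])
      show "coeff P (\<phi> h) (m * t) = \<zero>" for t
        using \<open>m \<noteq> 1\<close> by (simp add: h(2))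
    qed simp
    then show False
      using b_eq b_nz by simp
  qed
  have b_unit: "b \<in> Units R"
  proof -
    define e where "e = b \<otimes> f (coeff P h 1)"
    have e: "e \<in> carrier R"
      using h(1) by (simp add: e_def)
    have be: "b = e \<otimes> b"
      using b_eq \<open>m = 1\<close> by (simp add: e_def b_def)
    \<comment> \<open>Since b is nonzero, 1 - e cannot be a unit. Locality makes e a unit, and hence
      its factor b.\<close>
    then have "(\<one> \<ominus> e) \<otimes> b = \<zero>"
      using e by (simp add: a_minus_def R.l_distr R.l_minus R.r_neg)
    then have "\<one> \<ominus> e \<notin> Units R"
      using b_nz e by (metis R.Units_l_cancel R.Units_closed R.r_null R.zero_closed b)
    then have "e \<in> Units R"
      using local_ring.unit_or_one_minus_unit[OF loc e] by blast
    then show ?thesis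
      using h(1) R.unit_factor[of b "f (coeff P h 1)"] by (simp add: e_def)
  qed
  have kills: "f (coeff P p t) = \<zero>"
    if "p \<in> carrier P" and "\<And>t. j \<le> t \<Longrightarrow> coeff P (\<phi> p) (m * t) = \<zero>" and "j \<le> t" for p j t
    using annihilates[OF that] that(1) R.Units_l_cancel[OF b_unit, of "f (coeff P p t)" \<zero>] by simp
  have "f ` carrier R = carrier R"
  proof (intro equalityI subsetI)
    fix r assume r: "r \<in> carrier R"
    then obtain p where p: "p \<in> carrier P" "\<phi> p = monom P r 0"
      using surj by (metis imageE monom_closed)
    \<comment> \<open>The degrees m t with t \<ge> 1 are positive, where the constant r has no
      coefficient. Only the constant term of p then contributes to r.\<close>
    have tail: "f (coeff P p t) = \<zero>" if "1 \<le> t" for t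
    proof (rule kills[OF p(1) _ that])
      show "coeff P (\<phi> p) (m * t) = \<zero>" if "1 \<le> t" for t
        using m_pos that r by (simp add: p(2))
    qed
    have "f (coeff P p i) \<otimes> coeff P (g [^]\<^bsub>P\<^esub> i) 0 = (if 0 = i then f (coeff P p 0) else \<zero>)" for i
      using p(1) tail[of i] by (cases i) auto
    then have "coeff P (\<phi> p) 0 = (\<Oplus>i\<in>{..deg R p}. if 0 = i then f (coeff P p 0) else \<zero>)"
      using p(1) by (simp add: coeff_\<phi>)
    also have "\<dots> = f (coeff P p 0)"
      using p(1) R.finsum_singleton[of 0 "{..deg R p}" "\<lambda>_. f (coeff P p 0)"] by (simp add: Pi_def)
    finally have "r = f (coeff P p 0)"
      using r by (simp add: p(2))
    then show "r \<in> f ` carrier R"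
      by (rule image_eqI) (simp add: p(1))
  qed auto
  \<comment> \<open>The Hopfian hypothesis on R enters here.\<close>
  then have f_inj: "inj_on f (carrier R)"
    using hopf f_hom by (auto simp: hopfian_ring_def ring_iso_def bij_betw_def)
  have trivial_kernel: "p = \<zero>\<^bsub>P\<^esub>" if p: "p \<in> carrier P" "\<phi> p = \<zero>\<^bsub>P\<^esub>" for p
  proof (rule up_eqI)
    fix t
    have "f (coeff P p t) = f \<zero>"
      using kills[OF p(1), of 0 t] p(2) by simp
    then have "coeff P p t = \<zero>"
      by (rule inj_onD[OF f_inj]) (simp_all add: p(1))
    then show "coeff P p t = coeff P \<zero>\<^bsub>P\<^esub> t"
      by simp
  qed (use p in auto)
  have "a_kernel P P \<phi> = {\<zero>\<^bsub>P\<^esub>}"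
    unfolding a_kernel_def' using trivial_kernel \<phi>.hom_zero P.zero_closed by blast
  then show ?thesis
    using ring_hom_ring.trivial_ker_imp_inj[OF ring_hom_ringI2[OF P.ring_axioms P.ring_axioms \<phi>]]
    by blast
qed

section \<open>Passing the Hopfian property from R[x] to R\<close>

text \<open>Polynomials are represented by their coefficient functions, so one can be defined
  directly by its coefficients.\<close>

lemma mem_carrierI:
  assumes "\<And>i. c i \<in> carrier R" "\<And>i. n < i \<Longrightarrow> c i = \<zero>"
  shows "c \<in> carrier P" and "coeff P c i = c i"
proof -
  show "c \<in> carrier P"
    using assms by (auto simp: P_def UP_def intro!: mem_upI)
  then show "coeff P c i = c i"
    by (simp add: P_def UP_def)
qed

lemma map_coeffs_surjective_hom:
  assumes f: "f \<in> ring_hom R R" and surj: "f ` carrier R = carrier R"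
  defines "F \<equiv> \<lambda>p n. f (coeff P p n)"
  shows "F \<in> ring_hom P P" and "F ` carrier P = carrier P"
proof -
  interpret f: ring_hom_cring R R f
    using f R.is_cring by (simp add: ring_hom_cring_def ring_hom_cring_axioms_def)
  have closed: "F p \<in> carrier P" and coeff_F: "coeff P (F p) i = f (coeff P p i)"
    if "p \<in> carrier P" for p i
    using mem_carrierI[of "F p" "deg R p"] that by (auto simp: F_def deg_aboveD)
  show hom: "F \<in> ring_hom P P"
  proof (rule ring_hom_memI)
    fix p q assume pq: "p \<in> carrier P" "q \<in> carrier P"
    show "F (p \<otimes>\<^bsub>P\<^esub> q) = F p \<otimes>\<^bsub>P\<^esub> F q"
      by (rule up_eqI) (simp_all add: pq coeff_F closed Pi_def comp_def)
    show "F (p \<oplus>\<^bsub>P\<^esub> q) = F p \<oplus>\<^bsub>P\<^esub> F q"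
      by (rule up_eqI) (simp_all add: pq coeff_F closed)
  next
    show "F \<one>\<^bsub>P\<^esub> = \<one>\<^bsub>P\<^esub>"
      by (rule up_eqI) (simp_all add: coeff_F closed)
  qed (rule closed)
  show "F ` carrier P = carrier P"
  proof (intro equalityI subsetI)
    fix q assume q: "q \<in> carrier P"
    \<comment> \<open>Preimages are chosen coefficientwise. Zero is lifted explicitly to zero: an
      arbitrary choice could be a nonzero element of the kernel of f, and \<open>c\<close> would
      lose its finite support.\<close>
    define c where "c i = (if coeff P q i = \<zero> then \<zero> else inv_into (carrier R) f (coeff P q i))" for i
    have mem: "coeff P q i \<in> f ` carrier R" for i
      using q surj by simp
    have c: "c i \<in> carrier R" and fc: "f (c i) = coeff P q i" for i
      using inv_into_into[OF mem] f_inv_into_f[OF mem] by (auto simp: c_def)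
    have "c \<in> carrier P" and "\<And>i. coeff P c i = c i"
      using mem_carrierI[of c "deg R q"] c q by (auto simp: c_def deg_aboveD)
    moreover from this have "F c = q"
      using q by (intro up_eqI) (auto simp: coeff_F closed fc)
    ultimately show "q \<in> F ` carrier P"
      by blast
  qed (use closed in auto)
qed

text \<open>A surjective endomorphism of R extends coefficientwise to R[x]; the extension is
  injective, and restricting it to constants gives injectivity of the original map.\<close>

lemma hopfian_coefficient_ring:
  assumes "hopfian_ring P"
  shows "hopfian_ring R"
  unfolding hopfian_ring_def
proof (intro ballI impI)
  fix f assume f: "f \<in> ring_hom R R" and surj: "f ` carrier R = carrier R"
  let ?F = "\<lambda>p n. f (coeff P p n)"
  have inj: "inj_on ?F (carrier P)"
    using assms map_coeffs_surjective_hom[OF f surj]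
    by (auto simp: hopfian_ring_def ring_iso_def bij_betw_def)
  have "inj_on f (carrier R)"
  proof (rule inj_onI)
    fix a b assume ab: "a \<in> carrier R" "b \<in> carrier R" "f a = f b"
    then have "?F (monom P a 0) = ?F (monom P b 0)"
      by auto
    then have "monom P a 0 = monom P b 0"
      using inj_on_contraD[OF inj] ab(1,2) monom_closed by blast
    then show "a = b"
      using ab inj_onD[OF monom_inj] by blast
  qed
  then show "f \<in> ring_iso R R"
    using f surj by (simp add: ring_iso_def bij_betw_def)
qed

end

theorem theorem3p11:
  fixes R :: "('a, 'm) ring_scheme"
  assumes "local_ring R" and "reduced_ring R"
  shows "hopfian_ring R \<longleftrightarrow> hopfian_ring (UP R)"
proof -
  interpret UP_cring R "UP R"
    using assms(2) by (simp add: UP_cring_def reduced_ring_def)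
  have "hopfian_ring (UP R)" if "hopfian_ring R"
    using surjective_endomorphism_injective[OF assms that]
    by (simp add: hopfian_ring_def ring_iso_def bij_betw_def)
  then show ?thesis
    using hopfian_coefficient_ring by blast
qed

end
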